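(* The map $w \mapsto (\mathrm{P}_{\mathrm{mSt}}(w), \mathrm{Q}_{\mathrm{mSt}}(w))$ is a bijection between the elements of $\mathbb{N}^*$ and the set formed by the pairs $\bigl((T_L,T_R),(S_L,S_R)\bigr)$ where (i) $(T_L,T_R)$ is a pair of twin stalactic tableaux; (ii) $(S_L,S_R)$ is a pair of twin patience-sorting tableaux; (iii) $(T_L,T_R)$ and $(S_L,S_R)$ have the same shape (i.e. $T_L$ and $S_L$ have the same shape, and $T_R$ and $S_R$ have the same shape); (iv) for each $i$, the $i$-th column of $S_L$ corresponds, under the content-preserving bijection between columns of $S_L$ and columns of $S_R$, to the $\rho_{T_R}(\rho_{T_L}^{-1}(i))$-th column of $S_R$.
   Context: $\mathbb{N}=\{1,2,\dots\}$; $\mathbb{N}^*$ is the set of words over $\mathbb{N}$; $[n]=\{1,\dots,n\}$; $\mathrm{supp}(w)$ is the set of letters occurring in $w$. Tableaux. A composition diagram is a top-aligned finite sequence of (nonempty) columns of cells, with no condition on the column lengths; the shape of a labelled diagram is its underlying composition diagram. A stalactic tableau is a composition diagram with cells labelled by $\mathbb{N}$ such that all cells in a column have the same label and distinct columns have distinct labels. For a stalactic tableau $T$, $\mathrm{supp}(T)$ is its set of column labels, $\mathrm{cont}(T)$ records for each letter the number of cells labelled by it, and $\rho_T:\mathrm{supp}(T)\to[|\mathrm{supp}(T)|]$ sends a letter to the position (from the left) of its column. A column is simple if it has exactly one cell. An increasing (resp. decreasing) patience-sorting tableau is a composition diagram with $n$ cells labelled bijectively by $[n]$ (for some $n$) such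 that the top row is strictly increasing from left to right and columns are strictly increasing (resp. strictly decreasing) from top to bottom. P-symbols. $\mathrm{P}^{\to}_{\mathrm{lSt}}(w)$ is obtained from the empty tableau by reading $w$ left to right and inserting letters: to insert $a$, if $a$ labels no cell, add a new one-cell column labelled $a$ at the right; otherwise add a cell labelled $a$ to the bottom of the column labelled $a$. $\mathrm{P}^{\leftarrow}_{\mathrm{rSt}}(w)$ is obtained in the same way reading $w$ right to left and adding new columns at the left. $\mathrm{P}_{\mathrm{mSt}}(w)=(\mathrm{P}^{\to}_{\mathrm{lSt}}(w),\mathrm{P}^{\leftarrow}_{\mathrm{rSt}}(w))$. Q-symbols. $\overrightarrow{\rho_w}$ (resp. $\overleftarrow{\rho_w}$) is the bijection $\mathrm{supp}(w)\to[|\mathrm{supp}(w)|]$ sending a letter to its rank when the letters are ordered by the position of their first (resp. last) occurrence in $w$, reading left to right; it is applied to words letter by letter. For a word $z=z_1\cdots z_n$ over $\mathbb{N}$, the reverse-standardisation $\mathrm{rStd}(z)$ is the permutation of $[n]$ in one-line notation obtained by replacing each letter by its rank, where letters are compared by value first and, among equal letters, the one occurring further to the right is smaller. $\mathrm{Q}^{\to}_{\mathrm{lSt}}(w)$ is the increasing patience-sorting tableau obtained from the empty tableau by reading the permutation $\mathrm{rStd}(\overrightarrow{\rho_w}(w))^{-1}$ (in one-line notation) left to right and inserting letters: to insert $a$, if $a$ is greater than every top-row label, add a new one-cell column labelled $a$ at the right; otherwise, take the leftmost column whose topmost label is greater than $a$, shift all its labels down by one cell (adding a cell at the bottom), and label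 its top cell by $a$. $\mathrm{Q}^{\leftarrow}_{\mathrm{rSt}}(w)$ is the decreasing patience-sorting tableau obtained from the empty tableau by reading $\mathrm{rStd}(\overleftarrow{\rho_w}(w))^{-1}$ right to left and inserting letters: to insert $a$, if $a$ is less than every top-row label, add a new one-cell column labelled $a$ at the left; otherwise, take the rightmost column whose topmost label is less than $a$, shift all its labels down by one cell (adding a cell at the bottom), and label its top cell by $a$. $\mathrm{Q}_{\mathrm{mSt}}(w)=(\mathrm{Q}^{\to}_{\mathrm{lSt}}(w),\mathrm{Q}^{\leftarrow}_{\mathrm{rSt}}(w))$. Twin pairs. A pair $(T_L,T_R)$ of stalactic tableaux is a pair of twin stalactic tableaux if $\mathrm{cont}(T_L)=\mathrm{cont}(T_R)$ and, for each simple column labelled $c$ and any other column labelled $d$, $\rho_{T_L}(c)<\rho_{T_L}(d)$ implies $\rho_{T_R}(c)<\rho_{T_R}(d)$. A pair $(S_L,S_R)$ of an increasing and a decreasing patience-sorting tableau, respectively, is a pair of twin patience-sorting tableaux if there is a bijection between the columns of $S_L$ and those of $S_R$ such that corresponding columns have the same set of labels and, for corresponding columns $(c_L,c_R)$ and $(d_L,d_R)$ with $c_L,c_R$ simple, if $c_L$ is to the left of $d_L$ in $S_L$ then $c_R$ is to the left of $d_R$ in $S_R$. *)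

theory Defs
  imports Main
begin

(* Words over {1, 2, ...} are the elements of lists {1..} :: nat list set.
   A labelled composition diagram is the list of its columns from left to right, each column
   being the list of its labels from top to bottom.  Columns are numbered from 1. *)

type_synonym word = "nat list"
type_synonym tableau = "nat list list"

definition composition_diagram :: "tableau \<Rightarrow> bool" where
  "composition_diagram T \<longleftrightarrow> (\<forall>c\<in>set T. c \<noteq> [])"

definition shape :: "tableau \<Rightarrow> nat list" where
  "shape T = map length T"

definition col :: "tableau \<Rightarrow> nat \<Rightarrow> nat list" where
  "col T i = T ! (i - 1)"

definition columns :: "tableau \<Rightarrow> nat set" where
  "columns T = {1..length T}"

definition simple :: "nat list \<Rightarrow> bool" where
  "simple c \<longleftrightarrow> length c = 1"

abbreviation top_label :: "nat list \<Rightarrow> nat" where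
  "top_label c \<equiv> hd c"

definition supp :: "tableau \<Rightarrow> nat set" where
  "supp T = \<Union> (set ` set T)"

definition cont :: "tableau \<Rightarrow> nat \<Rightarrow> nat" where
  "cont T a = count_list (concat T) a"


subsection \<open>Stalactic tableaux\<close>

definition stalactic :: "tableau \<Rightarrow> bool" where
  "stalactic T \<longleftrightarrow>
     composition_diagram T \<and> supp T \<subseteq> {1..} \<and>
     (\<forall>c\<in>set T. \<forall>a\<in>set c. \<forall>b\<in>set c. a = b) \<and>
     (\<forall>i\<in>columns T. \<forall>j\<in>columns T. i \<noteq> j \<longrightarrow> set (col T i) \<inter> set (col T j) = {})"

(* Only meaningful for stalactic T and a in supp T. *)
definition rho :: "tableau \<Rightarrow> nat \<Rightarrow> nat" where
  "rho T a = (THE i. i \<in> columns T \<and> a \<in> set (col T i))"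

definition lSt_insert :: "tableau \<Rightarrow> nat \<Rightarrow> tableau" where
  "lSt_insert T a =
     (if a \<notin> supp T then T @ [[a]] else map (\<lambda>c. if a \<in> set c then c @ [a] else c) T)"

definition rSt_insert :: "tableau \<Rightarrow> nat \<Rightarrow> tableau" where
  "rSt_insert T a =
     (if a \<notin> supp T then [a] # T else map (\<lambda>c. if a \<in> set c then c @ [a] else c) T)"

definition P_lSt :: "word \<Rightarrow> tableau" where
  "P_lSt w = foldl lSt_insert [] w"

definition P_rSt :: "word \<Rightarrow> tableau" where
  "P_rSt w = foldl rSt_insert [] (rev w)"

definition P_mSt :: "word \<Rightarrow> tableau \<times> tableau" where
  "P_mSt w = (P_lSt w, P_rSt w)"


subsection \<open>Patience-sorting tableaux\<close>

definition labelled_by_interval :: "tableau \<Rightarrow> bool" where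
  "labelled_by_interval S \<longleftrightarrow> (\<exists>n. distinct (concat S) \<and> set (concat S) = {1..n})"

definition incr_patience_tableau :: "tableau \<Rightarrow> bool" where
  "incr_patience_tableau S \<longleftrightarrow>
     composition_diagram S \<and> labelled_by_interval S \<and>
     sorted_wrt (<) (map top_label S) \<and> (\<forall>c\<in>set S. sorted_wrt (<) c)"

definition decr_patience_tableau :: "tableau \<Rightarrow> bool" where
  "decr_patience_tableau S \<longleftrightarrow>
     composition_diagram S \<and> labelled_by_interval S \<and>
     sorted_wrt (<) (map top_label S) \<and> (\<forall>c\<in>set S. sorted_wrt (>) c)"

(* List positions i below are 0-based. *)

definition incr_patience_insert :: "tableau \<Rightarrow> nat \<Rightarrow> tableau" where
  "incr_patience_insert S a =
     (if \<forall>c\<in>set S. top_label c < a then S @ [[a]]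
      else let i = (LEAST i. i < length S \<and> a < top_label (S ! i)) in S[i := a # S ! i])"

definition decr_patience_insert :: "tableau \<Rightarrow> nat \<Rightarrow> tableau" where
  "decr_patience_insert S a =
     (if \<forall>c\<in>set S. a < top_label c then [a] # S
      else let i = (GREATEST i. i < length S \<and> top_label (S ! i) < a) in S[i := a # S ! i])"

definition first_occ :: "word \<Rightarrow> nat \<Rightarrow> nat" where
  "first_occ w a = (LEAST i. i < length w \<and> w ! i = a)"

definition last_occ :: "word \<Rightarrow> nat \<Rightarrow> nat" where
  "last_occ w a = (GREATEST i. i < length w \<and> w ! i = a)"

definition rho_first :: "word \<Rightarrow> nat \<Rightarrow> nat" where
  "rho_first w a = card {b \<in> set w. first_occ w b \<le> first_occ w a}"

definition rho_last :: "word \<Rightarrow> nat \<Rightarrow> nat" where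
  "rho_last w a = card {b \<in> set w. last_occ w b \<le> last_occ w a}"

definition rStd :: "word \<Rightarrow> nat list" where
  "rStd z =
     map (\<lambda>i. card {j. j < length z \<and> (z ! j < z ! i \<or> z ! j = z ! i \<and> i \<le> j)}) [0..<length z]"

(* One-line notation of the inverse of a permutation of {1..n} given in one-line notation. *)
definition perm_inverse :: "nat list \<Rightarrow> nat list" where
  "perm_inverse p = map (inv_into {1..length p} (\<lambda>i. p ! (i - 1))) [1..<Suc (length p)]"

definition Q_lSt :: "word \<Rightarrow> tableau" where
  "Q_lSt w = foldl incr_patience_insert [] (perm_inverse (rStd (map (rho_first w) w)))"

definition Q_rSt :: "word \<Rightarrow> tableau" where
  "Q_rSt w = foldl decr_patience_insert [] (rev (perm_inverse (rStd (map (rho_last w) w))))"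

definition Q_mSt :: "word \<Rightarrow> tableau \<times> tableau" where
  "Q_mSt w = (Q_lSt w, Q_rSt w)"


subsection \<open>Twin pairs\<close>

(* The label of a column of a stalactic tableau is its top entry. *)
definition twin_stalactic :: "tableau \<times> tableau \<Rightarrow> bool" where
  "twin_stalactic = (\<lambda>(TL, TR).
     stalactic TL \<and> stalactic TR \<and> cont TL = cont TR \<and>
     (\<forall>c\<in>set TL. \<forall>d\<in>set TL. simple c \<and> c \<noteq> d \<longrightarrow>
        rho TL (top_label c) < rho TL (top_label d) \<longrightarrow> rho TR (top_label c) < rho TR (top_label d)))"

definition content_preserving_bij :: "(nat \<Rightarrow> nat) \<Rightarrow> tableau \<Rightarrow> tableau \<Rightarrow> bool" where
  "content_preserving_bij f SL SR \<longleftrightarrow>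
     bij_betw f (columns SL) (columns SR) \<and>
     (\<forall>i\<in>columns SL. set (col SL i) = set (col SR (f i)))"

definition twin_patience :: "tableau \<times> tableau \<Rightarrow> bool" where
  "twin_patience = (\<lambda>(SL, SR).
     incr_patience_tableau SL \<and> decr_patience_tableau SR \<and>
     (\<exists>f. content_preserving_bij f SL SR \<and>
        (\<forall>i\<in>columns SL. \<forall>j\<in>columns SL.
           simple (col SL i) \<and> simple (col SR (f i)) \<longrightarrow> i < j \<longrightarrow> f i < f j)))"

(* Justifies speaking of "the" content-preserving bijection for patience-sorting tableaux. *)
lemma content_preserving_bij_unique:
  assumes "decr_patience_tableau SR"
    and f: "content_preserving_bij f SL SR" and g: "content_preserving_bij g SL SR"
    and i: "i \<in> columns SL"
  shows "f i = g i"
proof (rule ccontr)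
  assume ne: "f i \<noteq> g i"
  have d: "distinct (concat SR)" and n: "\<forall>c\<in>set SR. c \<noteq> []"
    using assms(1) by (auto simp: decr_patience_tableau_def labelled_by_interval_def
        composition_diagram_def)
  have fi: "f i \<in> columns SR" and gi: "g i \<in> columns SR"
    and e: "set (col SR (f i)) = set (col SR (g i))"
    using f g i by (auto simp: content_preserving_bij_def bij_betw_def)
  have "distinct SR"
    using d n by (auto simp: distinct_concat_iff removeAll_id)
  then have "col SR (f i) \<noteq> col SR (g i)"
    using fi gi ne by (auto simp: col_def columns_def nth_eq_iff_index_eq)
  moreover have mem: "col SR (f i) \<in> set SR" "col SR (g i) \<in> set SR"
    using fi gi by (auto simp: col_def columns_def)
  ultimately have "set (col SR (f i)) \<inter> set (col SR (g i)) = {}"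
    using d by (simp add: distinct_concat_iff)
  then show False using e mem n by auto
qed

end

theory Submission
  imports Defs
begin

text \<open>
  Let \<open>x\<^sub>1, \<dots>, x\<^sub>k\<close> be the letters of \<open>w\<close> in order of first occurrence. The inverse of the
  reverse-standardisation lists the positions of \<open>x\<^sub>1\<close> in decreasing order, then those of \<open>x\<^sub>2\<close>,
  and so on, so patience sorting reassembles them column by column: column \<open>i\<close> of \<open>Q_lSt w\<close> is the
  list of positions of \<open>x\<^sub>i\<close>, while column \<open>i\<close> of \<open>P_lSt w\<close> consists of copies of \<open>x\<^sub>i\<close>.
  Symmetrically for \<open>P_rSt\<close> and \<open>Q_rSt\<close>, with last occurrences. Hence the left-hand pair alone
  determines \<open>w\<close>. Conversely, filling the positions in column \<open>i\<close> of \<open>S\<^sub>L\<close> with the label of column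
  \<open>i\<close> of \<open>T\<^sub>L\<close> yields a word; the increasing top row of \<open>S\<^sub>L\<close> says that its letters have the right
  order of first occurrence, and condition (iv) together with the increasing top row of \<open>S\<^sub>R\<close> does
  the same for last occurrences.
\<close>

text \<open>Positions are counted from 1 because they serve as labels of the patience-sorting
  tableaux: for a letter \<open>a\<close> of \<open>w\<close>, this list is its column in
  \<open>Q_lSt w\<close>, and the reverse is its column in \<open>Q_rSt w\<close>.\<close>

definition occ :: "word \<Rightarrow> nat \<Rightarrow> nat list" where
  "occ w a = filter (\<lambda>j. w ! (j - 1) = a) [1..<Suc (length w)]"

text \<open>\<open>remdups\<close> keeps the last copy of each letter, so \<open>remdups w\<close>
  is the order of last occurrence; reversing before and after yields the order of first
  occurrence.\<close>

definition firsts :: "word \<Rightarrow> nat list" where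
  "firsts w = rev (remdups (rev w))"

text \<open>Normal form of a stalactic tableau: \<open>xs\<close> fixes the order of the columns and
  \<open>c\<close> their lengths. Where \<open>c\<close> vanishes the column would be empty, hence
  the positivity assumptions below.\<close>

definition stack :: "(nat \<Rightarrow> nat) \<Rightarrow> nat list \<Rightarrow> tableau" where
  "stack c xs = map (\<lambda>a. replicate (c a) a) xs"


subsection \<open>Occurrences of letters\<close>

lemma set_firsts [simp]: "set (firsts w) = set w"
  and distinct_firsts [simp]: "distinct (firsts w)"
  and firsts_Nil [simp]: "firsts [] = []"
  and firsts_snoc: "firsts (w @ [a]) = (if a \<in> set w then firsts w else firsts w @ [a])"
  by (auto simp: firsts_def)

lemma set_occ: "set (occ w a) = {j \<in> {1..length w}. w ! (j - 1) = a}"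
  by (auto simp: occ_def)

lemma sorted_occ: "sorted_wrt (<) (occ w a)"
  unfolding occ_def by (intro sorted_wrt_filter) (rule sorted_wrt_upt)

lemma distinct_occ [simp]: "distinct (occ w a)"
  by (simp add: occ_def)

lemma occ_snoc: "occ (w @ [a]) b = occ w b @ (if a = b then [Suc (length w)] else [])"
proof -
  have "filter (\<lambda>j. (w @ [a]) ! (j - 1) = b) [1..<Suc (length w)] = occ w b"
    unfolding occ_def by (rule filter_cong) (auto simp: nth_append)
  then show ?thesis by (simp add: occ_def)
qed

lemma occ_Cons: "occ (a # w) b = (if a = b then [1] else []) @ map Suc (occ w b)"
proof -
  have u: "[1..<Suc (length (a # w))] = 1 # map Suc [1..<Suc (length w)]"
    by (simp add: map_Suc_upt upt_conv_Cons del: upt_Suc)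
  have "filter ((\<lambda>j. (a # w) ! (j - 1) = b) \<circ> Suc) [1..<Suc (length w)] = occ w b"
    unfolding occ_def by (rule filter_cong) (auto simp: nth_Cons split: nat.split)
  then show ?thesis
    unfolding occ_def[of "a # w"] u by (auto simp: filter_map simp del: upt_Suc)
qed

lemma length_occ: "length (occ w a) = count_list w a"
  by (induction w) (auto simp: occ_Cons, simp add: occ_def)

lemma occ_eq_Nil_iff: "occ w a = [] \<longleftrightarrow> a \<notin> set w"
  by (metis length_0_conv length_occ count_list_0_iff)

lemma sorted_hd_le:
  fixes c :: "nat list"
  assumes "sorted_wrt (<) c" "x \<in> set c"
  shows "hd c \<le> x"
  using assms by (cases c) auto

lemma sorted_le_last:
  fixes c :: "nat list"
  assumes "sorted_wrt (<) c" "x \<in> set c"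
  shows "x \<le> last c"
  using assms by (cases c rule: rev_cases) (auto simp: sorted_wrt_append)

text \<open>Appending a letter leaves the first positions of the old letters alone, and a new letter
  gets a position beyond all of them.\<close>

lemma sorted_firsts: "sorted_wrt (\<lambda>a b. hd (occ w a) < hd (occ w b)) (firsts w)"
proof (induction w rule: rev_induct)
  case (snoc a w)
  have hd: "hd (occ (w @ [a]) b) = hd (occ w b)" if "b \<in> set w" for b
    using that by (simp add: occ_snoc hd_append occ_eq_Nil_iff)
  have le: "hd (occ w b) < Suc (length w)" if "b \<in> set w" for b
    using that occ_eq_Nil_iff[of w b] hd_in_set[of "occ w b"] by (auto simp: set_occ)
  have "sorted_wrt (\<lambda>b c. hd (occ (w @ [a]) b) < hd (occ (w @ [a]) c)) (firsts w)"
    by (rule sorted_wrt_mono_rel[OF _ snoc.IH]) (simp add: hd)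
  moreover have "occ (w @ [a]) a = [Suc (length w)]" if "a \<notin> set w"
    using that by (simp add: occ_snoc occ_eq_Nil_iff)
  ultimately show ?case
    by (auto simp: firsts_snoc sorted_wrt_append hd le)
qed simp

text \<open>Prepending a letter shifts all old positions by one, and a new letter gets position 1,
  before all of them.\<close>

lemma sorted_remdups: "sorted_wrt (\<lambda>a b. last (occ w a) < last (occ w b)) (remdups w)"
proof (induction w)
  case (Cons a w)
  have last: "last (occ (a # w) b) = Suc (last (occ w b))" if "b \<in> set w" for b
    using that by (simp add: occ_Cons last_map occ_eq_Nil_iff)
  have pos: "0 < last (occ w b)" if "b \<in> set w" for b
    using that occ_eq_Nil_iff[of w b] last_in_set[of "occ w b"] by (auto simp: set_occ)
  have "sorted_wrt (\<lambda>b c. last (occ (a # w) b) < last (occ (a # w) c)) (remdups w)"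
    by (rule sorted_wrt_mono_rel[OF _ Cons.IH]) (simp add: last)
  moreover have "occ (a # w) a = [1]" if "a \<notin> set w"
    using that by (simp add: occ_Cons occ_eq_Nil_iff)
  ultimately show ?case
    by (auto simp: last pos)
qed simp

section \<open>First and last positions, and the ranks they define\<close>

lemma hd_occ: "a \<in> set w \<Longrightarrow> hd (occ w a) = Suc (first_occ w a)"
proof -
  assume a: "a \<in> set w"
  then have ne: "occ w a \<noteq> []" by (simp add: occ_eq_Nil_iff)
  have h: "hd (occ w a) \<in> {j \<in> {1..length w}. w ! (j - 1) = a}"
    using hd_in_set[OF ne] by (simp add: set_occ)
  \<comment> \<open>\<open>first_occ\<close> counts from 0 and \<open>occ\<close> from 1, hence the
    shift.\<close>
  have "first_occ w a = hd (occ w a) - 1"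
    unfolding first_occ_def
  proof (rule Least_equality)
    show "hd (occ w a) - 1 < length w \<and> w ! (hd (occ w a) - 1) = a" using h by auto
    fix y assume "y < length w \<and> w ! y = a"
    then have "Suc y \<in> set (occ w a)" by (auto simp: set_occ)
    then show "hd (occ w a) - 1 \<le> y" using sorted_hd_le[OF sorted_occ] by fastforce
  qed
  then show ?thesis using h by auto
qed

lemma last_occ: "a \<in> set w \<Longrightarrow> last (occ w a) = Suc (last_occ w a)"
proof -
  assume a: "a \<in> set w"
  then have ne: "occ w a \<noteq> []" by (simp add: occ_eq_Nil_iff)
  have h: "last (occ w a) \<in> {j \<in> {1..length w}. w ! (j - 1) = a}"
    using last_in_set[OF ne] by (simp add: set_occ)
  have "last_occ w a = last (occ w a) - 1"
    unfolding last_occ_def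
  proof (rule Greatest_equality)
    show "last (occ w a) - 1 < length w \<and> w ! (last (occ w a) - 1) = a" using h by auto
    fix y assume "y < length w \<and> w ! y = a"
    then have "Suc y \<in> set (occ w a)" by (auto simp: set_occ)
    then show "y \<le> last (occ w a) - 1" using sorted_le_last[OF sorted_occ] by fastforce
  qed
  then show ?thesis using h by auto
qed

text \<open>The set counted by \<open>rho_first w a\<close> is contained in the one for
  \<open>b\<close>, and properly so, because it misses \<open>b\<close> itself.\<close>

lemma rho_first_less:
  assumes "b \<in> set w" "first_occ w a < first_occ w b"
  shows "rho_first w a < rho_first w b"
  unfolding rho_first_def
proof (intro psubset_card_mono psubsetI)
  show "{x \<in> set w. first_occ w x \<le> first_occ w a} \<noteq> {x \<in> set w. first_occ w x \<le> first_occ w b}"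
    using assms by (metis (mono_tags, lifting) mem_Collect_eq not_le order_refl)
qed (use assms in auto)

lemma rho_last_less:
  assumes "b \<in> set w" "last_occ w a < last_occ w b"
  shows "rho_last w a < rho_last w b"
  unfolding rho_last_def
proof (intro psubset_card_mono psubsetI)
  show "{x \<in> set w. last_occ w x \<le> last_occ w a} \<noteq> {x \<in> set w. last_occ w x \<le> last_occ w b}"
    using assms by (metis (mono_tags, lifting) mem_Collect_eq not_le order_refl)
qed (use assms in auto)


subsection \<open>The P-symbols\<close>

lemma P_lSt_eq: "P_lSt w = stack (count_list w) (firsts w)"
proof (induction w rule: rev_induct)
  case (snoc a w)
  have "supp (stack (count_list w) (firsts w)) = set w"
    by (auto simp: supp_def stack_def count_list_0_iff)
  then show ?case using snoc
    by (auto simp: P_lSt_def lSt_insert_def stack_def firsts_snoc count_list_0_iff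
        replicate_append_same)
qed (simp add: P_lSt_def stack_def)

text \<open>The word is read from the right, so prepending a letter is one more insertion; for
  \<open>P_lSt\<close> it is appending, hence the different inductions.\<close>

lemma P_rSt_eq: "P_rSt w = stack (count_list w) (remdups w)"
proof (induction w)
  case (Cons a w)
  have "supp (stack (count_list w) (remdups w)) = set w"
    by (auto simp: supp_def stack_def count_list_0_iff)
  then show ?case using Cons
    by (auto simp: P_rSt_def rSt_insert_def stack_def count_list_0_iff
        replicate_append_same)
qed (simp add: P_rSt_def stack_def)


subsection \<open>The Q-symbols\<close>

text \<open>The relation is the order by which reverse-standardisation ranks positions, so
  \<open>q\<close> lists the positions by increasing rank; sending a rank to its position is the
  inverse permutation.\<close>

lemma perm_inverse_rStd:
  assumes set_q: "set q = {1..length z}"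
    and sorted: "sorted_wrt (\<lambda>i j. z ! (i - 1) < z ! (j - 1) \<or> z ! (i - 1) = z ! (j - 1) \<and> j < i) q"
      (is "sorted_wrt ?R q")
  shows "perm_inverse (rStd z) = q"
proof -
  let ?n = "length z"
  let ?p = "rStd z"
  have R: "?R (q ! k) (q ! m)" if "k < m" "m < length q" for k m
    using sorted_wrt_nth_less[OF sorted that] .
  \<comment> \<open>\<open>?R\<close> is irreflexive, so a sorted list has no repetition.\<close>
  have "distinct q"
    unfolding distinct_conv_nth
  proof (intro allI impI)
    fix i j assume "i < length q" "j < length q" "i \<noteq> j"
    then show "q ! i \<noteq> q ! j" using R[of i j] R[of j i] by (cases "i < j") auto
  qed
  then have len: "length q = ?n" using distinct_card[of q] set_q by simp
  have lenp: "length ?p = ?n" by (simp add: rStd_def)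
  have q_range: "q ! k \<in> {1..?n}" if "k < ?n" for k
    using that set_q len nth_mem by metis
  have p: "?p ! (q ! m - 1) = Suc m" if m: "m < ?n" for m
  proof -
    let ?i = "q ! m - 1"
    have i: "?i < ?n" using q_range[OF m] by auto
    \<comment> \<open>The positions counted in the rank of \<open>q ! m\<close> are the entries of
      \<open>q\<close> up to and including index \<open>m\<close>, which makes the rank
      \<open>Suc m\<close>.\<close>
    have "{j. j < ?n \<and> (z ! j < z ! ?i \<or> z ! j = z ! ?i \<and> ?i \<le> j)} = (\<lambda>k. q ! k - 1) ` {..m}"
    proof (intro equalityI subsetI)
      fix j assume j: "j \<in> {j. j < ?n \<and> (z ! j < z ! ?i \<or> z ! j = z ! ?i \<and> ?i \<le> j)}"
      then have "Suc j \<in> set q" using set_q by auto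
      then obtain k where k: "k < ?n" "q ! k = Suc j" using len by (auto simp: in_set_conv_nth)
      have "\<not> m < k"
      proof
        assume "m < k"
        then have "?R (q ! m) (q ! k)" using k len by (intro R) simp_all
        then show False using j k q_range[OF m] by auto
      qed
      then show "j \<in> (\<lambda>k. q ! k - 1) ` {..m}" using k by (auto intro!: image_eqI[of _ _ k])
    next
      fix j assume "j \<in> (\<lambda>k. q ! k - 1) ` {..m}"
      then obtain k where k: "k \<le> m" "j = q ! k - 1" by auto
      then have "k = m \<or> ?R (q ! k) (q ! m)" using R[of k m] m len by fastforce
      then show "j \<in> {j. j < ?n \<and> (z ! j < z ! ?i \<or> z ! j = z ! ?i \<and> ?i \<le> j)}"
        using k q_range[of k] m i by auto
    qed
    moreover have "inj_on (\<lambda>k. q ! k - 1) {..m}"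
    proof (rule inj_onI)
      fix k l assume kl: "k \<in> {..m}" "l \<in> {..m}" "q ! k - 1 = q ! l - 1"
      then have "q ! k = q ! l" using q_range[of k] q_range[of l] m by auto
      then show "k = l" using \<open>distinct q\<close> kl m len by (simp add: nth_eq_iff_index_eq)
    qed
    ultimately show ?thesis using i by (simp add: rStd_def card_image)
  qed
  have ex: "\<exists>k<?n. q ! k = x" if "x \<in> {1..?n}" for x
    using that set_q len by (metis in_set_conv_nth)
  have inj: "inj_on (\<lambda>i. ?p ! (i - 1)) {1..?n}"
    by (rule inj_onI) (metis ex p Suc_inject)
  show ?thesis
  proof (rule nth_equalityI)
    show "length (perm_inverse ?p) = length q" by (simp add: perm_inverse_def lenp len del: upt_Suc)
    fix m assume "m < length (perm_inverse ?p)"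
    then have m: "m < ?n" by (simp add: perm_inverse_def lenp del: upt_Suc)
    have "inv_into {1..?n} (\<lambda>i. ?p ! (i - 1)) (Suc m) = q ! m"
      by (rule inv_into_f_eq[OF inj q_range[OF m] p[OF m]])
    then show "perm_inverse ?p ! m = q ! m"
      using m by (simp add: perm_inverse_def lenp del: upt_Suc)
  qed
qed

lemma sorted_wrt_concat_map:
  assumes "\<And>x. x \<in> set xs \<Longrightarrow> sorted_wrt R (f x)"
    and "sorted_wrt (\<lambda>x y. \<forall>a\<in>set (f x). \<forall>b\<in>set (f y). R a b) xs"
  shows "sorted_wrt R (concat (map f xs))"
  using assms by (induction xs) (auto simp: sorted_wrt_append)

text \<open>Among equal letters the rightmost is ranked lowest, so each letter contributes one block
  with its positions in decreasing order; the blocks follow the values of \<open>g\<close>.\<close>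

lemma perm_inverse_rStd_map:
  assumes set_xs: "set xs = set w" and g: "sorted_wrt (\<lambda>a b. g a < g b) xs"
  shows "perm_inverse (rStd (map g w)) = concat (map (\<lambda>a. rev (occ w a)) xs)"
proof (rule perm_inverse_rStd)
  show "set (concat (map (\<lambda>a. rev (occ w a)) xs)) = {1..length (map g w)}"
    by (auto simp: set_xs set_occ intro!: bexI[of _ "w ! (_ - 1)"])
  show "sorted_wrt (\<lambda>i j. map g w ! (i - 1) < map g w ! (j - 1) \<or>
      map g w ! (i - 1) = map g w ! (j - 1) \<and> j < i) (concat (map (\<lambda>a. rev (occ w a)) xs))"
  proof (rule sorted_wrt_concat_map)
    fix a
    show "sorted_wrt (\<lambda>i j. map g w ! (i - 1) < map g w ! (j - 1) \<or>
        map g w ! (i - 1) = map g w ! (j - 1) \<and> j < i) (rev (occ w a))"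
      unfolding sorted_wrt_rev
      by (rule sorted_wrt_mono_rel[OF _ sorted_occ]) (auto simp: set_occ)
  next
    show "sorted_wrt (\<lambda>a b. \<forall>i\<in>set (rev (occ w a)). \<forall>j\<in>set (rev (occ w b)).
        map g w ! (i - 1) < map g w ! (j - 1) \<or>
        map g w ! (i - 1) = map g w ! (j - 1) \<and> j < i) xs"
      by (rule sorted_wrt_mono_rel[OF _ g]) (auto simp: set_occ)
  qed
qed

section \<open>Patience sorting rebuilds a tableau column by column\<close>

lemma incr_patience_insert_new:
  assumes "\<forall>d\<in>set S. top_label d < a"
  shows "incr_patience_insert S a = S @ [[a]]"
  using assms by (simp add: incr_patience_insert_def)

lemma incr_patience_insert_last:
  assumes "\<forall>d\<in>set S. top_label d < a" "a < top_label c"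
  shows "incr_patience_insert (S @ [c]) a = S @ [a # c]"
proof -
  have "(LEAST i. i < length (S @ [c]) \<and> a < top_label ((S @ [c]) ! i)) = length S"
  proof (rule Least_equality)
    fix i assume i: "i < length (S @ [c]) \<and> a < top_label ((S @ [c]) ! i)"
    show "length S \<le> i"
      using i assms(1) by (metis nth_append nth_mem not_le less_asym)
  qed (simp add: assms)
  then show ?thesis using assms(2) by (auto simp: incr_patience_insert_def)
qed

text \<open>Reading the column from bottom to top, the first label opens a new column at the right;
  each later one is smaller than the top of that column but larger than all other tops, so it lands
  there too.\<close>

lemma foldl_incr_patience_insert_column:
  assumes "c \<noteq> []" "sorted_wrt (<) c" "\<forall>d\<in>set S. \<forall>a\<in>set c. top_label d < a"
  shows "foldl incr_patience_insert S (rev c) = S @ [c]"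
  using assms
proof (induction c)
  case (Cons a c)
  show ?case
  proof (cases "c = []")
    case False
    then show ?thesis using Cons by (simp add: incr_patience_insert_last)
  qed (use Cons.prems in \<open>simp add: incr_patience_insert_new\<close>)
qed simp

lemma foldl_incr_patience_insert:
  assumes "\<forall>c\<in>set S. c \<noteq> [] \<and> sorted_wrt (<) c" "sorted_wrt (\<lambda>c d. hd c < hd d) S"
  shows "foldl incr_patience_insert [] (concat (map rev S)) = S"
  using assms
proof (induction S rule: rev_induct)
  case (snoc c S)
  \<comment> \<open>The top of an increasing column is its least entry, so comparing tops bounds the
    whole of \<open>c\<close> from below.\<close>
  have "\<forall>d\<in>set S. \<forall>a\<in>set c. top_label d < a"
    using snoc.prems sorted_hd_le by (fastforce simp: sorted_wrt_append)
  then show ?case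
    using snoc by (simp add: sorted_wrt_append foldl_incr_patience_insert_column)
qed simp

lemma decr_patience_insert_new:
  assumes "\<forall>d\<in>set S. a < top_label d"
  shows "decr_patience_insert S a = [a] # S"
  using assms by (simp add: decr_patience_insert_def)

lemma decr_patience_insert_first:
  assumes "\<forall>d\<in>set S. a < top_label d" "top_label c < a"
  shows "decr_patience_insert (c # S) a = (a # c) # S"
proof -
  have "(GREATEST i. i < length (c # S) \<and> top_label ((c # S) ! i) < a) = 0"
  proof (rule Greatest_equality)
    fix i assume i: "i < length (c # S) \<and> top_label ((c # S) ! i) < a"
    show "i \<le> 0"
      using i assms(1) by (cases i) (auto dest: nth_mem less_asym)
  qed (simp add: assms)
  then show ?thesis using assms(2) by (auto simp: decr_patience_insert_def)
qed

lemma foldl_decr_patience_insert_column: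
  assumes "c \<noteq> []" "sorted_wrt (>) c" "\<forall>d\<in>set S. \<forall>a\<in>set c. a < top_label d"
  shows "foldl decr_patience_insert S (rev c) = c # S"
  using assms
proof (induction c)
  case (Cons a c)
  show ?case
  proof (cases "c = []")
    case False
    then show ?thesis using Cons by (simp add: decr_patience_insert_first)
  qed (use Cons.prems in \<open>simp add: decr_patience_insert_new\<close>)
qed simp

text \<open>Mirror image: the top of a decreasing column is its greatest entry, and the columns are
  built from the rightmost one towards the left.\<close>

lemma foldl_decr_patience_insert:
  assumes "\<forall>c\<in>set S. c \<noteq> [] \<and> sorted_wrt (>) c" "sorted_wrt (\<lambda>c d. hd c < hd d) S"
  shows "foldl decr_patience_insert [] (concat (map rev (rev S))) = S"
  using assms
proof (induction S)
  case (Cons c S)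
  have "a \<le> hd c" if "a \<in> set c" for a
    using that Cons.prems(1) by (cases c) auto
  then have "\<forall>d\<in>set S. \<forall>a\<in>set c. a < top_label d"
    using Cons.prems by fastforce
  then show ?case
    using Cons by (simp add: foldl_decr_patience_insert_column)
qed simp

section \<open>Closed forms of the Q-symbols\<close>

lemma Q_lSt_eq: "Q_lSt w = map (occ w) (firsts w)"
proof -
  have "sorted_wrt (\<lambda>a b. rho_first w a < rho_first w b) (firsts w)"
    by (rule sorted_wrt_mono_rel[OF _ sorted_firsts]) (auto simp: hd_occ rho_first_less)
  then have "perm_inverse (rStd (map (rho_first w) w)) = concat (map rev (map (occ w) (firsts w)))"
    by (simp add: perm_inverse_rStd_map comp_def)
  then show ?thesis
    unfolding Q_lSt_def
    by (simp only:, intro foldl_incr_patience_insert)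
      (auto simp: sorted_occ occ_eq_Nil_iff sorted_wrt_map sorted_firsts)
qed

text \<open>Reading backwards turns each block of positions into an increasing run and takes the
  letters from last to first; each run is pushed on from above, which leaves the last occurrence on
  top.\<close>

lemma Q_rSt_eq: "Q_rSt w = map (\<lambda>a. rev (occ w a)) (remdups w)"
proof -
  have "sorted_wrt (\<lambda>a b. rho_last w a < rho_last w b) (remdups w)"
    by (rule sorted_wrt_mono_rel[OF _ sorted_remdups]) (auto simp: last_occ rho_last_less)
  then have "rev (perm_inverse (rStd (map (rho_last w) w))) =
      concat (map rev (rev (map (\<lambda>a. rev (occ w a)) (remdups w))))"
    by (simp add: perm_inverse_rStd_map[OF set_remdups] rev_concat rev_map comp_def)
  then show ?thesis
    unfolding Q_rSt_def
    by (simp only:, intro foldl_decr_patience_insert)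
      (auto simp: sorted_occ occ_eq_Nil_iff sorted_wrt_map sorted_wrt_rev hd_rev sorted_remdups)
qed


subsection \<open>Stalactic tableaux\<close>

context
  fixes c :: "nat \<Rightarrow> nat" and xs :: "nat list"
  assumes distinct: "distinct xs" and pos: "\<And>a. a \<in> set xs \<Longrightarrow> 0 < c a"
begin

lemma supp_stack: "supp (stack c xs) = set xs"
  using pos by (fastforce simp: supp_def stack_def)

lemma columns_stack: "columns (stack c xs) = {1..length xs}"
  by (simp add: columns_def stack_def)

lemma col_stack: "i \<in> {1..length xs} \<Longrightarrow> set (col (stack c xs) i) = {xs ! (i - 1)}"
  using pos by (fastforce simp: col_def stack_def)

lemma rho_stack: "i < length xs \<Longrightarrow> rho (stack c xs) (xs ! i) = Suc i"
  unfolding rho_def columns_stack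
  by (rule the_equality)
    (use distinct in \<open>auto simp: col_stack nth_eq_iff_index_eq\<close>)

lemma rho_stack_bij: "bij_betw (rho (stack c xs)) (set xs) {1..length xs}"
  unfolding bij_betw_def
proof
  show "inj_on (rho (stack c xs)) (set xs)"
    by (rule inj_onI) (auto simp: in_set_conv_nth rho_stack)
  show "rho (stack c xs) ` set xs = {1..length xs}"
  proof -
    have "rho (stack c xs) ` set xs = rho (stack c xs) ` (!) xs ` {0..<length xs}"
      by (metis list.set_map map_nth set_upt)
    also have "\<dots> = Suc ` {0..<length xs}"
      unfolding image_image by (rule image_cong) (auto simp: rho_stack)
    finally show ?thesis by (simp add: atLeastLessThanSuc_atLeastAtMost)
  qed
qed

lemma col_map_rho_stack: "a \<in> set xs \<Longrightarrow> col (map g xs) (rho (stack c xs) a) = g a"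
  by (auto simp: in_set_conv_nth rho_stack col_def)

text \<open>Lets columns be compared through any key increasing along \<open>xs\<close>; the keys
  used are the first and the last position of a letter.\<close>

lemma rho_stack_less_iff:
  fixes k :: "nat \<Rightarrow> nat"
  assumes sorted: "sorted_wrt (\<lambda>a b. k a < k b) xs" and "a \<in> set xs" "b \<in> set xs"
  shows "rho (stack c xs) a < rho (stack c xs) b \<longleftrightarrow> k a < k b"
proof -
  obtain i j where ij: "i < length xs" "j < length xs" "a = xs ! i" "b = xs ! j"
    using assms by (metis in_set_conv_nth)
  have less: "k (xs ! m) < k (xs ! n)" if "m < n" "n < length xs" for m n
    using sorted_wrt_nth_less[OF sorted that] .
  show ?thesis
    using less[of i j] less[of j i] ij by (cases i j rule: linorder_cases) (auto simp: rho_stack)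
qed

lemma cont_stack: "cont (stack c xs) a = (if a \<in> set xs then c a else 0)"
proof -
  have "count_list (replicate n b) a = (if a = b then n else 0)" for n b
    by (induction n) auto
  then show ?thesis
    using distinct unfolding cont_def stack_def by (induction xs) auto
qed

lemma stalactic_stack:
  assumes "set xs \<subseteq> {1..}"
  shows "stalactic (stack c xs)"
  unfolding stalactic_def supp_stack columns_stack
proof (intro conjI ballI impI)
  show "composition_diagram (stack c xs)"
    using pos by (auto simp: composition_diagram_def stack_def)
  show "a = b" if "d \<in> set (stack c xs)" "a \<in> set d" "b \<in> set d" for d a b
    using that by (auto simp: stack_def split: if_splits)
  show "set (col (stack c xs) i) \<inter> set (col (stack c xs) j) = {}"
    if "i \<in> {1..length xs}" "j \<in> {1..length xs}" "i \<noteq> j" for i j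
    using distinct that unfolding col_stack[OF that(1)] col_stack[OF that(2)]
    by (auto simp: nth_eq_iff_index_eq)
qed (rule assms)

end

text \<open>Distinct columns have distinct top labels, so the length of a column is a function of
  its label, and on the labels this function is the content.\<close>

lemma stalactic_obtain_stack:
  assumes T: "stalactic T"
  obtains xs where "distinct xs" "\<And>a. a \<in> set xs \<Longrightarrow> 0 < cont T a" "T = stack (cont T) xs"
    "set xs \<subseteq> {1..}"
proof
  let ?xs = "map hd T"
  \<comment> \<open>Provisional length function: \<open>inv_into\<close> recovers a column from its
    top label. \<open>cont_stack\<close> later identifies it with \<open>cont T\<close>.\<close>
  let ?c = "\<lambda>a. length (inv_into (set T) hd a)"
  have ne: "d \<noteq> []" if "d \<in> set T" for d
    using that T by (auto simp: stalactic_def composition_diagram_def)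
  show distinct: "distinct ?xs"
    unfolding distinct_conv_nth
  proof (intro allI impI)
    fix i j assume ij: "i < length ?xs" "j < length ?xs" "i \<noteq> j"
    then have "set (col T (Suc i)) \<inter> set (col T (Suc j)) = {}"
      using T by (simp add: stalactic_def columns_def)
    then have "set (T ! i) \<inter> set (T ! j) = {}" by (simp add: col_def)
    moreover have "hd (T ! i) \<in> set (T ! i)" "hd (T ! j) \<in> set (T ! j)"
      using ij ne by auto
    ultimately show "?xs ! i \<noteq> ?xs ! j" using ij by auto
  qed
  then have inv: "inv_into (set T) hd (hd d) = d" if "d \<in> set T" for d
    using that by (simp add: distinct_map)
  have rep: "replicate (length d) (hd d) = d" if "d \<in> set T" for d
    using that T ne[OF that] hd_in_set[of d]
    by (intro replicate_length_same) (auto simp: stalactic_def)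
  have T_eq: "T = stack ?c ?xs"
    by (simp add: stack_def comp_def inv rep map_idI cong: map_cong)
  have c_pos: "0 < ?c a" if "a \<in> set ?xs" for a
    using that ne by (auto simp: inv)
  have cont: "cont T a = ?c a" if "a \<in> set ?xs" for a
    using that cont_stack[of ?xs ?c a] distinct c_pos T_eq by simp
  show "0 < cont T a" if "a \<in> set ?xs" for a
    using that c_pos cont by simp
  show "T = stack (cont T) ?xs"
    by (subst T_eq) (auto simp: stack_def cont simp del: map_map)
  show "set ?xs \<subseteq> {1..}"
    using T hd_in_set[OF ne] by (fastforce simp: stalactic_def supp_def)
qed


subsection \<open>The correspondence\<close>

lemma count_list_pos: "a \<in> set w \<Longrightarrow> 0 < count_list w a"
  using count_list_0_iff by fastforce

text \<open>The source of both twin conditions: the first and last occurrences of a letter occurring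
  once coincide.\<close>
lemma rho_P_mono:
  assumes ab: "a \<in> set w" "b \<in> set w" and single: "count_list w a = 1"
    and less: "rho (P_lSt w) a < rho (P_lSt w) b"
  shows "rho (P_rSt w) a < rho (P_rSt w) b"
proof -
  have "hd (occ w a) < hd (occ w b)"
    using less ab unfolding P_lSt_eq
    by (subst (asm) rho_stack_less_iff[OF _ _ sorted_firsts]) (auto simp: count_list_pos)
  moreover have "last (occ w a) = hd (occ w a)"
    using single length_occ[of w a] by (cases "occ w a") auto
  moreover have "hd (occ w b) \<le> last (occ w b)"
    using ab by (intro sorted_hd_le[OF sorted_occ] last_in_set) (simp add: occ_eq_Nil_iff)
  ultimately have "last (occ w a) < last (occ w b)" by simp
  then show ?thesis
    using ab unfolding P_rSt_eq
    by (subst rho_stack_less_iff[OF _ _ sorted_remdups]) (auto simp: count_list_pos)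
qed

lemma twin_stalactic_P_mSt:
  assumes "set w \<subseteq> {1..}"
  shows "twin_stalactic (P_lSt w, P_rSt w)"
proof -
  have "stalactic (P_lSt w)" "stalactic (P_rSt w)"
    unfolding P_lSt_eq P_rSt_eq using assms by (auto intro!: stalactic_stack simp: count_list_pos)
  moreover have "cont (P_lSt w) = cont (P_rSt w)"
  proof
    fix a
    have "cont (P_lSt w) a = (if a \<in> set w then count_list w a else 0)"
      unfolding P_lSt_eq by (subst cont_stack) (auto simp: count_list_pos)
    moreover have "cont (P_rSt w) a = (if a \<in> set w then count_list w a else 0)"
      unfolding P_rSt_eq by (subst cont_stack) (auto simp: count_list_pos)
    ultimately show "cont (P_lSt w) a = cont (P_rSt w) a" by simp
  qed
  moreover have "rho (P_rSt w) (hd c) < rho (P_rSt w) (hd d)"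
    if cd: "c \<in> set (P_lSt w)" "d \<in> set (P_lSt w)" "simple c"
      "rho (P_lSt w) (hd c) < rho (P_lSt w) (hd d)" for c d
  proof -
    obtain a b where ab: "a \<in> set w" "c = replicate (count_list w a) a"
      "b \<in> set w" "d = replicate (count_list w b) b"
      using cd(1,2) by (auto simp: P_lSt_eq stack_def)
    then have "hd c = a" "hd d = b" "count_list w a = 1"
      using cd(3) by (auto simp: simple_def count_list_0_iff)
    then show ?thesis using rho_P_mono[of a w b] ab cd(4) by simp
  qed
  ultimately show ?thesis by (auto simp: twin_stalactic_def)
qed

text \<open>Every position of \<open>w\<close> carries exactly one letter, so the lists of positions
  partition \<open>{1..length w}\<close>.\<close>

lemma labelled_by_interval_occ:
  assumes "distinct xs" "set xs = set w"
  shows "labelled_by_interval (map (occ w) xs)" "labelled_by_interval (map (\<lambda>a. rev (occ w a)) xs)"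
proof -
  have "distinct (concat (map (occ w) xs))" "distinct (concat (map (\<lambda>a. rev (occ w a)) xs))"
    using assms(1)
    by (induction xs) (auto simp: set_occ)
  moreover have "(\<Union>a\<in>set xs. set (occ w a)) = {1..length w}"
    using assms(2) by (auto simp: set_occ)
  ultimately show "labelled_by_interval (map (occ w) xs)"
    "labelled_by_interval (map (\<lambda>a. rev (occ w a)) xs)"
    by (auto simp: labelled_by_interval_def)
qed

lemma incr_patience_tableau_Q_lSt: "incr_patience_tableau (Q_lSt w)"
  using labelled_by_interval_occ[of "firsts w" w]
  by (auto simp: incr_patience_tableau_def Q_lSt_eq composition_diagram_def occ_eq_Nil_iff
      sorted_occ sorted_wrt_map sorted_firsts comp_def)

lemma decr_patience_tableau_Q_rSt: "decr_patience_tableau (Q_rSt w)"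
  using labelled_by_interval_occ[of "remdups w" w]
  by (auto simp: decr_patience_tableau_def Q_rSt_eq composition_diagram_def occ_eq_Nil_iff
      sorted_occ sorted_wrt_map sorted_wrt_rev hd_rev sorted_remdups comp_def)

text \<open>The map \<open>f\<close> goes from a left column index to its letter and on to the right
  column index of that letter, so matched columns both consist of the positions of one
  letter.\<close>

lemma Q_mSt_columns:
  fixes w
  defines "f \<equiv> \<lambda>i. rho (P_rSt w) (inv_into (supp (P_lSt w)) (rho (P_lSt w)) i)"
  shows content_preserving_bij_Q_mSt: "content_preserving_bij f (Q_lSt w) (Q_rSt w)"
    and twin_patience_Q_mSt: "twin_patience (Q_lSt w, Q_rSt w)"
proof -
  let ?rl = "rho (P_lSt w)" and ?rr = "rho (P_rSt w)"
  have supp: "supp (P_lSt w) = set w"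
    unfolding P_lSt_eq by (subst supp_stack) (auto simp: count_list_pos)
  have cols: "columns (Q_lSt w) = {1..length (firsts w)}" "columns (Q_rSt w) = {1..length (remdups w)}"
    by (simp_all add: columns_def Q_lSt_eq Q_rSt_eq)
  have bl: "bij_betw ?rl (set w) (columns (Q_lSt w))"
    using rho_stack_bij[of "firsts w" "count_list w"] by (simp add: P_lSt_eq cols count_list_pos)
  have br: "bij_betw ?rr (set w) (columns (Q_rSt w))"
    using rho_stack_bij[of "remdups w" "count_list w"] by (simp add: P_rSt_eq cols count_list_pos)
  have letter: "\<exists>a\<in>set w. i = ?rl a \<and> f i = ?rr a \<and> col (Q_lSt w) i = occ w a \<and>
      col (Q_rSt w) (f i) = rev (occ w a)" if "i \<in> columns (Q_lSt w)" for i
  proof -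
    have "i \<in> ?rl ` set w" using bl that by (simp add: bij_betw_def)
    then obtain a where a: "a \<in> set w" "i = ?rl a" by blast
    then have f: "f i = ?rr a"
      using bl by (simp add: f_def supp bij_betw_inv_into_left)
    have "col (Q_lSt w) (?rl a) = occ w a"
      unfolding P_lSt_eq Q_lSt_eq using a(1) by (subst col_map_rho_stack) (auto simp: count_list_pos)
    moreover have "col (Q_rSt w) (?rr a) = rev (occ w a)"
      unfolding P_rSt_eq Q_rSt_eq using a(1) by (subst col_map_rho_stack) (auto simp: count_list_pos)
    ultimately show ?thesis using a f by auto
  qed
  have "bij_betw f (columns (Q_lSt w)) (columns (Q_rSt w))"
    using bij_betw_trans[OF bij_betw_inv_into[OF bl] br] by (simp add: f_def supp comp_def)
  then show cpb: "content_preserving_bij f (Q_lSt w) (Q_rSt w)"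
    using letter by (fastforce simp: content_preserving_bij_def)
  \<comment> \<open>A simple column belongs to a letter occurring once, so \<open>rho_P_mono\<close>
    applies.\<close>
  have "f i < f j" if "i \<in> columns (Q_lSt w)" "j \<in> columns (Q_lSt w)"
    "simple (col (Q_lSt w) i)" "i < j" for i j
    using letter[OF that(1)] letter[OF that(2)] that(3,4) rho_P_mono
    by (auto simp: simple_def length_occ)
  then show "twin_patience (Q_lSt w, Q_rSt w)"
    using cpb incr_patience_tableau_Q_lSt decr_patience_tableau_Q_rSt
    by (auto simp: twin_patience_def)
qed

lemma shape_P_Q: "shape (P_lSt w) = shape (Q_lSt w)" "shape (P_rSt w) = shape (Q_rSt w)"
  by (auto simp: shape_def P_lSt_eq Q_lSt_eq P_rSt_eq Q_rSt_eq stack_def length_occ)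

section \<open>Injectivity\<close>

lemma P_lSt_Q_lSt_inj:
  assumes P: "P_lSt v = P_lSt w" and Q: "Q_lSt v = Q_lSt w"
  shows "v = w"
proof -
  have hd: "map hd (P_lSt u) = firsts u" for u
    by (auto simp: P_lSt_eq stack_def count_list_0_iff intro!: map_idI)
  have firsts: "firsts v = firsts w" using P hd by metis
  have occ_eq: "occ v a = occ w a" if "a \<in> set v" for a
  proof -
    have "map (occ v) (firsts v) = map (occ w) (firsts v)"
      using Q firsts by (simp add: Q_lSt_eq)
    then show ?thesis using that by (simp only: map_eq_conv set_firsts)
  qed
  have set: "set v = set w" using firsts by (metis set_firsts)
  \<comment> \<open>The columns of the Q-symbol together hold all positions, so they determine the
    length of the word.\<close>
  have "{1..length v} = {1..length w}"
  proof -
    have "(\<Union>a\<in>set u. set (occ u a)) = {1..length u}" for u by (auto simp: set_occ)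
    then show ?thesis using occ_eq set by (metis (no_types, lifting) SUP_cong)
  qed
  then have "card {1..length v} = card {1..length w}" by (rule arg_cong)
  then have len: "length v = length w" by simp
  show ?thesis
  proof (rule nth_equalityI[OF len])
    fix i assume i: "i < length v"
    then have "Suc i \<in> set (occ v (v ! i))" by (simp add: set_occ)
    then have "Suc i \<in> set (occ w (v ! i))" using occ_eq i by simp
    then show "v ! i = w ! i" by (simp add: set_occ)
  qed
qed

section \<open>Surjectivity\<close>

lemma sorted_wrt_key_unique:
  fixes k :: "'a \<Rightarrow> nat"
  assumes "sorted_wrt (\<lambda>a b. k a < k b) xs" "sorted_wrt (\<lambda>a b. k a < k b) ys" "set xs = set ys"
  shows "xs = ys"
  using assms
proof (induction xs arbitrary: ys)
  case (Cons x xs)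
  then obtain y zs where ys: "ys = y # zs" by (cases ys) auto
  have "x \<in> set (y # zs)" "y \<in> set (x # xs)"
    using Cons.prems(3) unfolding ys by (metis list.set_intros(1))+
  \<comment> \<open>Each head is the only element of least key in the common set.\<close>
  then have "x = y"
    using Cons.prems(1,2) unfolding ys by fastforce
  moreover have "x \<notin> set xs" "y \<notin> set zs"
    using Cons.prems(1,2) by (auto simp: ys)
  ultimately have "x = y" "set xs = set zs"
    using Cons.prems(3) by (auto simp: ys)
  then show ?case using Cons ys by simp
qed simp

lemma mSt_surj:
  assumes twin_T: "twin_stalactic (TL, TR)" and twin_S: "twin_patience (SL, SR)"
    and shape: "shape TL = shape SL" "shape TR = shape SR"
    and f: "content_preserving_bij f SL SR"
      "\<forall>i\<in>columns SL. f i = rho TR (inv_into (supp TL) (rho TL) i)"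
  obtains w where "w \<in> lists {1..}" "P_mSt w = (TL, TR)" "Q_mSt w = (SL, SR)"
proof -
  have T: "stalactic TL" "stalactic TR" "cont TL = cont TR"
    using twin_T by (auto simp: twin_stalactic_def)
  have S: "incr_patience_tableau SL" "decr_patience_tableau SR"
    using twin_S by (auto simp: twin_patience_def)
  \<comment> \<open>Twins have equal content, so one length function serves both tableaux.\<close>
  define c where "c = cont TL"
  obtain xs where xs: "distinct xs" "\<And>a. a \<in> set xs \<Longrightarrow> 0 < c a" "TL = stack c xs" "set xs \<subseteq> {1..}"
    using stalactic_obtain_stack[OF T(1)] unfolding c_def by metis
  obtain ys where ys: "distinct ys" "\<And>a. a \<in> set ys \<Longrightarrow> 0 < c a" "TR = stack c ys"
    using stalactic_obtain_stack[OF T(2)] unfolding c_def T(3) by metis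
  have set_eq: "set xs = set ys"
  proof -
    have "a \<in> set xs \<longleftrightarrow> 0 < cont TL a" for a
      using xs(2)[of a] unfolding xs(3) by (subst cont_stack[OF xs(1,2)]) auto
    moreover have "a \<in> set ys \<longleftrightarrow> 0 < cont TR a" for a
      using ys(2)[of a] unfolding ys(3) by (subst cont_stack[OF ys(1,2)]) auto
    ultimately show ?thesis using T(3) by auto
  qed
  have len_SL: "length SL = length xs"
    using shape(1) by (metis length_map shape_def stack_def xs(3))
  have len_SR: "length SR = length ys"
    using shape(2) by (metis length_map shape_def stack_def ys(3))
  have "map length SL = map c xs"
    using shape(1) by (simp add: xs(3) stack_def shape_def comp_def)
  then have col_len: "length (SL ! i) = c (xs ! i)" if "i < length xs" for i
    using that len_SL by (metis nth_map)
  obtain n where n: "distinct (concat SL)" "set (concat SL) = {1..n}"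
    using S(1) by (auto simp: incr_patience_tableau_def labelled_by_interval_def)
  have disj: "i = j" if "i < length xs" "j < length xs" "p \<in> set (SL ! i)" "p \<in> set (SL ! j)" for i j p
  proof (rule ccontr)
    assume "i \<noteq> j"
    moreover have "distinct SL"
      using S(1) n(1) by (auto simp: incr_patience_tableau_def composition_diagram_def
          distinct_concat_iff)
    ultimately have "SL ! i \<noteq> SL ! j" using that len_SL by (simp add: nth_eq_iff_index_eq)
    moreover have "SL ! i \<in> set SL" "SL ! j \<in> set SL" using that len_SL by auto
    ultimately have "set (SL ! i) \<inter> set (SL ! j) = {}" using n(1) by (simp add: distinct_concat_iff)
    then show False using that by blast
  qed
  \<comment> \<open>Meaningful for \<open>p\<close> in \<open>{1..n}\<close>: such a label lies in
    some column of \<open>SL\<close>, and by \<open>disj\<close> in only one.\<close>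
  define column where "column p = (THE i. i < length xs \<and> p \<in> set (SL ! i))" for p
  have column: "column p = i" if "i < length xs" "p \<in> set (SL ! i)" for p i
    unfolding column_def using that disj by (intro the_equality) auto
  have ex_column: "\<exists>i<length xs. p \<in> set (SL ! i)" if "p \<in> {1..n}" for p
  proof -
    have "p \<in> set (concat SL)" using that n(2) by simp
    then obtain d where "d \<in> set SL" "p \<in> set d" by auto
    then show ?thesis using len_SL by (metis in_set_conv_nth)
  qed
  \<comment> \<open>The candidate preimage: each position gets the label that \<open>TL\<close> has
    at the index of its column in \<open>SL\<close>.\<close>
  define w where "w = map (\<lambda>p. xs ! column p) [1..<Suc n]"
  have len_w: "length w = n" by (simp add: w_def)
  have w_nth: "w ! (p - 1) = xs ! column p" if "p \<in> {1..n}" for p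
    using that by (auto simp: w_def simp del: upt_Suc)
  have occ_w: "occ w (xs ! i) = SL ! i" if i: "i < length xs" for i
  proof -
    have sorted: "sorted_wrt (<) (SL ! i)"
      using S(1) i len_SL by (simp add: incr_patience_tableau_def)
    have "set (SL ! i) = set (occ w (xs ! i))"
    proof (intro equalityI subsetI)
      fix p assume p: "p \<in> set (SL ! i)"
      then have "p \<in> {1..n}" using n(2) i len_SL by (metis UN_I nth_mem set_concat)
      then show "p \<in> set (occ w (xs ! i))"
        using w_nth column[OF i p] by (simp add: set_occ len_w)
    next
      fix p assume "p \<in> set (occ w (xs ! i))"
      then have p: "p \<in> {1..n}" "w ! (p - 1) = xs ! i" by (auto simp: set_occ len_w)
      obtain j where j: "j < length xs" "p \<in> set (SL ! j)" using ex_column p(1) by blast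
      then have "xs ! j = xs ! i" using column[OF j] p w_nth by simp
      then show "p \<in> set (SL ! i)" using j i xs(1) by (simp add: nth_eq_iff_index_eq)
    qed
    then show ?thesis using strict_sorted_equal[OF sorted sorted_occ] by simp
  qed
  have set_w: "set w = set xs"
  proof (intro equalityI subsetI)
    fix a assume "a \<in> set w"
    then have "a \<in> (\<lambda>p. xs ! column p) ` {1..n}"
      by (simp add: w_def atLeastLessThanSuc_atLeastAtMost del: upt_Suc)
    then obtain p where "p \<in> {1..n}" "a = xs ! column p" by blast
    then show "a \<in> set xs" using ex_column column by (metis nth_mem)
  next
    fix a assume "a \<in> set xs"
    then obtain i where i: "i < length xs" "a = xs ! i" by (metis in_set_conv_nth)
    \<comment> \<open>Columns have positive length, so every label of \<open>TL\<close> does occur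
      in \<open>w\<close>.\<close>
    then have "occ w a \<noteq> []"
      using occ_w col_len xs(2) by (metis length_greater_0_conv nth_mem)
    then show "a \<in> set w" by (simp add: occ_eq_Nil_iff)
  qed
  have c_w: "count_list w a = c a" if "a \<in> set xs" for a
    using that occ_w col_len by (metis in_set_conv_nth length_occ)
  have SL_eq: "SL = map (occ w) xs"
    by (rule nth_equalityI) (auto simp: len_SL occ_w)
  \<comment> \<open>The increasing top row of \<open>SL\<close> puts \<open>xs\<close> in order of
    first occurrence.\<close>
  have "sorted_wrt (\<lambda>a b. hd (occ w a) < hd (occ w b)) xs"
    using S(1) by (simp add: incr_patience_tableau_def SL_eq sorted_wrt_map)
  then have xs_eq: "xs = firsts w"
    using sorted_wrt_key_unique[OF _ sorted_firsts] set_w by simp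
  \<comment> \<open>Condition (iv) enters here: if \<open>xs ! i = ys ! m\<close>, then
    \<open>f\<close> takes column \<open>Suc i\<close> of \<open>SL\<close> to column
    \<open>Suc m\<close> of \<open>SR\<close>, so both hold the positions of the same letter. The
    reversal appears because columns of \<open>SR\<close> decrease.\<close>
  have SR_nth: "SR ! m = rev (occ w (ys ! m))" if m: "m < length ys" for m
  proof -
    obtain i where i: "i < length xs" "xs ! i = ys ! m"
      using m set_eq by (metis in_set_conv_nth nth_mem)
    have Suc_i: "Suc i \<in> columns SL" using i len_SL by (simp add: columns_def)
    have "inv_into (supp TL) (rho TL) (Suc i) = ys ! m"
      using rho_stack[of xs c, OF xs(1,2) i(1)] rho_stack_bij[of xs c, OF xs(1,2)] i
        supp_stack[of xs c, OF xs(1,2)] nth_mem[OF i(1)]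
      by (intro inv_into_f_eq) (auto simp: bij_betw_def simp flip: xs(3))
    then have "f (Suc i) = Suc m"
      using f(2) Suc_i rho_stack[of ys c, OF ys(1,2) m] by (simp add: ys(3))
    then have "set (SR ! m) = set (SL ! i)"
      using f(1) Suc_i by (force simp: content_preserving_bij_def col_def)
    then have "set (rev (SR ! m)) = set (occ w (ys ! m))"
      using occ_w[OF i(1)] i(2) by simp
    moreover have "sorted_wrt (<) (rev (SR ! m))"
      using S(2) m len_SR by (simp add: decr_patience_tableau_def sorted_wrt_rev)
    ultimately have "rev (SR ! m) = occ w (ys ! m)"
      by (intro strict_sorted_equal) (auto simp: sorted_occ)
    then show ?thesis by (simp add: rev_swap)
  qed
  have SR_eq: "SR = map (\<lambda>a. rev (occ w a)) ys"
    by (rule nth_equalityI) (auto simp: len_SR SR_nth)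
  \<comment> \<open>The top of a column of \<open>SR\<close> is the last occurrence of its letter,
    so the increasing top row puts \<open>ys\<close> in order of last occurrence.\<close>
  have "sorted_wrt (\<lambda>a b. last (occ w a) < last (occ w b)) ys"
    using S(2) by (simp add: decr_patience_tableau_def SR_eq sorted_wrt_map hd_rev)
  then have ys_eq: "ys = remdups w"
    using sorted_wrt_key_unique[OF _ sorted_remdups] set_w set_eq by simp
  have "stack c xs = P_lSt w" "stack c ys = P_rSt w"
    using c_w set_eq by (auto simp: P_lSt_eq P_rSt_eq stack_def simp flip: xs_eq ys_eq)
  then have "P_mSt w = (TL, TR)" by (simp add: P_mSt_def xs(3) ys(3))
  moreover have "Q_mSt w = (SL, SR)"
    by (simp add: Q_mSt_def Q_lSt_eq Q_rSt_eq SL_eq SR_eq xs_eq ys_eq)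
  moreover have "w \<in> lists {1..}" using set_w xs(4) by auto
  ultimately show thesis by (rule that[rotated])
qed

theorem theorem4p8:
  shows "bij_betw (\<lambda>w. (P_mSt w, Q_mSt w)) (lists {1..})
    {((TL, TR), (SL, SR)).
       twin_stalactic (TL, TR) \<and>
       twin_patience (SL, SR) \<and>
       shape TL = shape SL \<and> shape TR = shape SR \<and>
       (\<exists>f. content_preserving_bij f SL SR \<and>
          (\<forall>i\<in>columns SL. f i = rho TR (inv_into (supp TL) (rho TL) i)))}"
    (is "bij_betw ?F _ ?B")
  unfolding bij_betw_def
proof
  show "inj_on ?F (lists {1..})"
    by (rule inj_onI) (simp add: P_mSt_def Q_mSt_def P_lSt_Q_lSt_inj)
  show "?F ` lists {1..} = ?B"
  proof (intro equalityI subsetI)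
    fix x assume "x \<in> ?F ` lists {1..}"
    then obtain w where "set w \<subseteq> {1..}" "x = ((P_lSt w, P_rSt w), (Q_lSt w, Q_rSt w))"
      by (auto simp: P_mSt_def Q_mSt_def)
    moreover have "\<exists>f. content_preserving_bij f (Q_lSt w) (Q_rSt w) \<and> (\<forall>i\<in>columns (Q_lSt w).
        f i = rho (P_rSt w) (inv_into (supp (P_lSt w)) (rho (P_lSt w)) i))"
      using content_preserving_bij_Q_mSt by blast
    ultimately show "x \<in> ?B"
      using twin_stalactic_P_mSt twin_patience_Q_mSt shape_P_Q by auto
  next
    fix x assume "x \<in> ?B"
    then obtain TL TR SL SR f where x: "x = ((TL, TR), (SL, SR))"
      and twin: "twin_stalactic (TL, TR)" "twin_patience (SL, SR)" "shape TL = shape SL"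
        "shape TR = shape SR" "content_preserving_bij f SL SR"
        "\<forall>i\<in>columns SL. f i = rho TR (inv_into (supp TL) (rho TL) i)"
      by auto
    obtain w where "w \<in> lists {1..}" "P_mSt w = (TL, TR)" "Q_mSt w = (SL, SR)"
      using mSt_surj[OF twin] .
    then show "x \<in> ?F ` lists {1..}" by (intro image_eqI[of _ _ w]) (simp_all add: x)
  qed
qed

end
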